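(* Let $\Gamma=(X,E)$ be a finite connected simple graph with base vertex $x_0\in X$, and let $D$ be the diameter of $\Gamma$ with respect to $x_0$. Suppose that $\Gamma$ has exactly $D+1$ distinct eigenvalues $\lambda_0,\dots,\lambda_D$, with multiplicities $m_0,\dots,m_D$ respectively. Set $t:=\sharp\{i : m_i>1\}$. Then, as $\mathbb{C}$-algebras, $\mathcal{T}_1(\Gamma,x_0)\cong M_{D+1}(\mathbb{C})\oplus\bigoplus_{i=1}^t\mathbb{C}$. In particular, $\dim\mathcal{T}_1(\Gamma,x_0)=(D+1)^2+t$.
   Context: Let $A$ be the adjacency matrix of $\Gamma$, an element of the algebra $M_X(\mathbb{C})$ of complex matrices with rows and columns indexed by $X$. Eigenvalues of $\Gamma$ are the eigenvalues of $A$. The diameter of $\Gamma$ with respect to $x_0$ is $\max\{\partial(x_0,y): y\in X\}$, where $\partial$ is the graph distance. $E_{x_0}\in M_X(\mathbb{C})$ is the matrix whose $(x_0,x_0)$-entry is $1$ and whose other entries are $0$. $\mathcal{T}_1(\Gamma,x_0)=\mathbb{C}\langle A,E_{x_0}\rangle$ is the unital $\mathbb{C}$-subalgebra of $M_X(\mathbb{C})$ generated by $A$ and $E_{x_0}$. *)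

theory Defs
  imports
    "HOL-Analysis.Analysis"
    "HOL-Algebra.QuotRing"
    "Jordan_Normal_Form.Matrix"
begin

section \<open>Finite simple graphs\<close>

text \<open>
  A finite simple graph \<open>\<Gamma> = (X, E)\<close> has as its vertex set \<open>X\<close> the universe of a type \<open>'x\<close> of class
  \<open>finite\<close>, so that the square matrices indexed by \<open>X\<close> are \<open>complex^'x^'x\<close>. Edges are two-element
  sets of vertices.
\<close>

definition simple_graph :: "'x::finite set set \<Rightarrow> bool" where
  "simple_graph E \<longleftrightarrow> (\<forall>e\<in>E. card e = 2)"

definition adjacent :: "'x::finite set set \<Rightarrow> 'x \<Rightarrow> 'x \<Rightarrow> bool" where
  "adjacent E x y \<longleftrightarrow> {x, y} \<in> E"

definition connected_graph :: "'x::finite set set \<Rightarrow> bool" where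
  "connected_graph E \<longleftrightarrow> (\<forall>x y. (adjacent E)\<^sup>*\<^sup>* x y)"

text \<open>
  The least length of a walk; it is meaningful only for vertices in the same connected component.
\<close>

definition graph_dist :: "'x::finite set set \<Rightarrow> 'x \<Rightarrow> 'x \<Rightarrow> nat" where
  "graph_dist E x y = (LEAST n. (adjacent E ^^ n) x y)"

definition diameter_at :: "'x::finite set set \<Rightarrow> 'x \<Rightarrow> nat" where
  "diameter_at E x0 = Max {graph_dist E x0 y | y. y \<in> UNIV}"


section \<open>Adjacency matrix and eigenvalues\<close>

definition adj_matrix :: "'x::finite set set \<Rightarrow> complex^'x^'x" where
  "adj_matrix E = (\<chi> x y. if adjacent E x y then 1 else 0)"

definition eigenspace :: "complex^'x^'x \<Rightarrow> complex \<Rightarrow> (complex^'x::finite) set" where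
  "eigenspace A c = {v. A *v v = c *s v}"

definition eigenvalues :: "complex^'x^'x::finite \<Rightarrow> complex set" where
  "eigenvalues A = {c. \<exists>v. v \<noteq> 0 \<and> A *v v = c *s v}"

text \<open>
  The geometric multiplicity. It is only used for adjacency matrices, which are real symmetric, so
  that geometric and algebraic multiplicities agree.
\<close>

definition eig_mult :: "complex^'x^'x::finite \<Rightarrow> complex \<Rightarrow> nat" where
  "eig_mult A c = vector_space.dim ((*s) :: complex \<Rightarrow> complex^'x \<Rightarrow> complex^'x) (eigenspace A c)"


section \<open>The algebra of complex matrices indexed by the vertices\<close>

definition mat_scale :: "complex \<Rightarrow> complex^'x^'x \<Rightarrow> complex^'x^'x::finite" where
  "mat_scale c M = (\<chi> x. c *s (M $ x))"

interpretation cmat: vector_space "mat_scale :: complex \<Rightarrow> complex^'x^'x \<Rightarrow> complex^'x^'x::finite"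
  by unfold_locales
    (simp_all add: mat_scale_def Finite_Cartesian_Product.vec_eq_iff algebra_simps)

definition unital_subalgebra :: "(complex^'x^'x::finite) set \<Rightarrow> bool" where
  "unital_subalgebra S \<longleftrightarrow>
     cmat.subspace S \<and> Finite_Cartesian_Product.mat 1 \<in> S \<and> (\<forall>M\<in>S. \<forall>N\<in>S. M ** N \<in> S)"

text \<open>
  A \<open>\<complex>\<close>-algebra is represented by a record of type \<open>(complex, _) module\<close>, which has the ring
  operations and the scalar multiplication. (The locale \<open>algebra\<close> of HOL-Algebra asks for a
  commutative ring and therefore does not apply here.)
\<close>

definition subalgebra_of_cmat :: "(complex^'x^'x::finite) set \<Rightarrow> (complex, complex^'x^'x) module" where
  "subalgebra_of_cmat S =
     \<lparr>carrier = S, mult = (**), one = Finite_Cartesian_Product.mat 1, zero = 0, add = (+),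
      smult = mat_scale\<rparr>"

lemma unital_subalgebra_hull: "unital_subalgebra (unital_subalgebra hull G)"
  unfolding hull_def unital_subalgebra_def cmat.subspace_def by auto


section \<open>Isomorphisms and direct sums of algebras\<close>

definition alg_iso ::
  "(complex, 'a) module \<Rightarrow> (complex, 'b) module \<Rightarrow> ('a \<Rightarrow> 'b) set" where
  "alg_iso A B = {h \<in> ring_iso A B. \<forall>c. \<forall>a\<in>carrier A. h (c \<odot>\<^bsub>A\<^esub> a) = c \<odot>\<^bsub>B\<^esub> h a}"

definition alg_isomorphic :: "(complex, 'a) module \<Rightarrow> (complex, 'b) module \<Rightarrow> bool" where
  "alg_isomorphic A B \<longleftrightarrow> alg_iso A B \<noteq> {}"

definition alg_direct_sum ::
  "(complex, 'a) module \<Rightarrow> (complex, 'b) module \<Rightarrow> (complex, 'a \<times> 'b) module" where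
  "alg_direct_sum A B =
     \<lparr>carrier = carrier A \<times> carrier B,
      mult = (\<lambda>(a, b) (a', b'). (a \<otimes>\<^bsub>A\<^esub> a', b \<otimes>\<^bsub>B\<^esub> b')),
      one = (\<one>\<^bsub>A\<^esub>, \<one>\<^bsub>B\<^esub>),
      zero = (\<zero>\<^bsub>A\<^esub>, \<zero>\<^bsub>B\<^esub>),
      add = (\<lambda>(a, b) (a', b'). (a \<oplus>\<^bsub>A\<^esub> a', b \<oplus>\<^bsub>B\<^esub> b')),
      smult = (\<lambda>c (a, b). (c \<odot>\<^bsub>A\<^esub> a, c \<odot>\<^bsub>B\<^esub> b))\<rparr>"

text \<open>
  The direct sum of a finite family, its elements being the functions on \<open>I\<close> that are \<open>undefined\<close>
  outside \<open>I\<close>.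
\<close>

definition alg_direct_sum_family ::
  "'i set \<Rightarrow> ('i \<Rightarrow> (complex, 'a) module) \<Rightarrow> (complex, 'i \<Rightarrow> 'a) module" where
  "alg_direct_sum_family I F =
     \<lparr>carrier = (\<Pi>\<^sub>E i\<in>I. carrier (F i)),
      mult = (\<lambda>f g. \<lambda>i\<in>I. f i \<otimes>\<^bsub>F i\<^esub> g i),
      one = (\<lambda>i\<in>I. \<one>\<^bsub>F i\<^esub>),
      zero = (\<lambda>i\<in>I. \<zero>\<^bsub>F i\<^esub>),
      add = (\<lambda>f g. \<lambda>i\<in>I. f i \<oplus>\<^bsub>F i\<^esub> g i),
      smult = (\<lambda>c f. \<lambda>i\<in>I. c \<odot>\<^bsub>F i\<^esub> f i)\<rparr>"

definition complex_algebra :: "(complex, complex) module" where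
  "complex_algebra =
     \<lparr>carrier = UNIV, mult = (*), one = 1, zero = 0, add = (+), smult = (*)\<rparr>"

text \<open>The record \<open>module_mat\<close> has matrix multiplication and the identity as its ring structure.\<close>

definition full_matrix_algebra :: "nat \<Rightarrow> (complex, complex Matrix.mat) module" where
  "full_matrix_algebra n = module_mat TYPE(complex) n n"


section \<open>The algebra generated by \<open>A\<close> and \<open>E\<^sub>x\<^sub>0\<close>\<close>

definition base_matrix :: "'x::finite \<Rightarrow> complex^'x^'x" where
  "base_matrix x0 = (\<chi> x y. if x = x0 \<and> y = x0 then 1 else 0)"

definition T1_set :: "'x::finite set set \<Rightarrow> 'x \<Rightarrow> (complex^'x^'x) set" where
  "T1_set E x0 = unital_subalgebra hull {adj_matrix E, base_matrix x0}"

definition T1_algebra :: "'x::finite set set \<Rightarrow> 'x \<Rightarrow> (complex, complex^'x^'x) module" where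
  "T1_algebra E x0 = subalgebra_of_cmat (T1_set E x0)"

end

(*
  Let e be the basis vector of x0, B = e e^T the base matrix and P_i the spectral projections of A,
  which are polynomials in A. A vertex at distance D from x0 shows that e, A e, ..., A^D e are
  linearly independent; as A has only D + 1 eigenvalues, every P_i e is nonzero. Hence
  c_i = <P_i e, e> = |P_i e|^2 is nonzero, and since B P_j B = c_j B, the elements
  U_ij = P_i B P_j / c_j are matrix units. The remainders Q_i = P_i - U_ii are orthogonal
  idempotents annihilated by all matrix units, and Q_i = 0 exactly when the eigenspace of l_i is
  spanned by P_i e. The algebra is spanned by the U_ij and the nonzero Q_i.
*)
theory Submission
  imports Defs "HOL-Computational_Algebra.Fundamental_Theorem_Algebra"
begin

section \<open>Matrix and algebra preliminaries\<close>

lemma mat_scale_nth [simp]: "mat_scale c M $ i $ j = c * M $ i $ j"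
  by (simp add: mat_scale_def)

lemma mat_scale_mult_left [simp]: "mat_scale c M ** N = mat_scale c (M ** N)"
  by (simp add: Finite_Cartesian_Product.vec_eq_iff matrix_matrix_mult_def sum_distrib_left mult_ac)

lemma mat_scale_mult_right [simp]: "M ** mat_scale c N = mat_scale c (M ** N)"
  by (simp add: Finite_Cartesian_Product.vec_eq_iff matrix_matrix_mult_def sum_distrib_left mult_ac)

lemma mat_scale_mult_vec [simp]: "mat_scale c M *v v = c *s (M *v v)"
  by (simp add: Finite_Cartesian_Product.vec_eq_iff matrix_vector_mult_def sum_distrib_left mult_ac)

lemma mat_scale_if:
  "mat_scale (if P then 1 else 0) M = (if P then M else 0)"
  "mat_scale c (if P then M else 0) = (if P then mat_scale c M else 0)"
  by simp_all

lemma matrix_zero_mult [simp]: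
  fixes N :: "complex^'x^'x::finite"
  shows "0 ** N = 0" "N ** 0 = 0"
  by (simp_all add: Finite_Cartesian_Product.vec_eq_iff matrix_matrix_mult_def)

lemma matrix_add_mult_left:
  fixes M N L :: "complex^'x^'x::finite"
  shows "(M + N) ** L = M ** L + N ** L"
  by (simp add: Finite_Cartesian_Product.vec_eq_iff matrix_matrix_mult_def sum.distrib distrib_right)

lemma matrix_sum_mult_left:
  fixes f :: "'i \<Rightarrow> complex^'x^'x::finite" and N :: "complex^'x^'x"
  shows "sum f I ** N = (\<Sum>i\<in>I. f i ** N)"
  by (induction I rule: infinite_finite_induct) (simp_all add: matrix_add_mult_left)

lemma matrix_sum_mult_right:
  fixes f :: "'i \<Rightarrow> complex^'x^'x::finite" and N :: "complex^'x^'x"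
  shows "N ** sum f I = (\<Sum>i\<in>I. N ** f i)"
  by (induction I rule: infinite_finite_induct) (simp_all add: matrix_add_ldistrib)

lemma matrix_diff_mult:
  fixes M N L :: "complex^'x^'x::finite"
  shows "(M - N) ** L = M ** L - N ** L" "L ** (M - N) = L ** M - L ** N"
  by (simp_all add: Finite_Cartesian_Product.vec_eq_iff matrix_matrix_mult_def sum_subtractf
      left_diff_distrib right_diff_distrib)

lemma matrix_sum_mult_vec:
  fixes f :: "'i \<Rightarrow> complex^'x^'x::finite"
  shows "sum f I *v v = (\<Sum>k\<in>I. f k *v v)"
  by (induction I rule: infinite_finite_induct) (simp_all add: matrix_vector_mult_add_rdistrib)

text \<open>The natural map sends coordinates to matrices, that is, from the block algebra into the
  generated algebra. The isomorphism wanted goes the other way, so the homomorphism laws are carried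
  over to the inverse map.\<close>

lemma alg_iso_inv_into:
  fixes A :: "(complex, 'a) module" and B :: "(complex, 'b) module"
  assumes h: "bij_betw h (carrier B) (carrier A)"
    and closed: "\<And>x y. x \<in> carrier B \<Longrightarrow> y \<in> carrier B \<Longrightarrow> x \<otimes>\<^bsub>B\<^esub> y \<in> carrier B"
      "\<And>x y. x \<in> carrier B \<Longrightarrow> y \<in> carrier B \<Longrightarrow> x \<oplus>\<^bsub>B\<^esub> y \<in> carrier B"
      "\<And>c x. x \<in> carrier B \<Longrightarrow> c \<odot>\<^bsub>B\<^esub> x \<in> carrier B" "\<one>\<^bsub>B\<^esub> \<in> carrier B"
    and hom: "\<And>x y. x \<in> carrier B \<Longrightarrow> y \<in> carrier B \<Longrightarrow> h (x \<otimes>\<^bsub>B\<^esub> y) = h x \<otimes>\<^bsub>A\<^esub> h y"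
      "\<And>x y. x \<in> carrier B \<Longrightarrow> y \<in> carrier B \<Longrightarrow> h (x \<oplus>\<^bsub>B\<^esub> y) = h x \<oplus>\<^bsub>A\<^esub> h y"
      "\<And>c x. x \<in> carrier B \<Longrightarrow> h (c \<odot>\<^bsub>B\<^esub> x) = c \<odot>\<^bsub>A\<^esub> h x" "h \<one>\<^bsub>B\<^esub> = \<one>\<^bsub>A\<^esub>"
  shows "inv_into (carrier B) h \<in> alg_iso A B"
proof -
  let ?g = "inv_into (carrier B) h"
  have g: "bij_betw ?g (carrier A) (carrier B)"
    using h by (rule bij_betw_inv_into)
  have gin: "?g a \<in> carrier B" if "a \<in> carrier A" for a
    using g that by (rule bij_betw_apply)
  have hg: "h (?g a) = a" if "a \<in> carrier A" for a
    using h that by (rule bij_betw_inv_into_right)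
  have eq: "?g a = b" if "b \<in> carrier B" "h b = a" for a b
    using bij_betw_inv_into_left[OF h] that by blast
  show ?thesis
    unfolding alg_iso_def using gin closed
    by (auto intro!: ring_iso_memI eq simp: hom hg g)
qed

section \<open>The target algebra and its operations on pairs\<close>

definition block_algebra :: "nat \<Rightarrow> nat \<Rightarrow> (complex, complex Matrix.mat \<times> (nat \<Rightarrow> complex)) module" where
  "block_algebra n t =
     alg_direct_sum (full_matrix_algebra n) (alg_direct_sum_family {1..t} (\<lambda>i. complex_algebra))"

lemma carrier_block_algebra:
  "carrier (block_algebra n t) = carrier_mat n n \<times> ({1..t} \<rightarrow>\<^sub>E UNIV)"
  by (simp add: block_algebra_def alg_direct_sum_def full_matrix_algebra_def module_mat_def
      alg_direct_sum_family_def complex_algebra_def)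

lemma block_algebra_simps:
  "(M, f) \<otimes>\<^bsub>block_algebra n t\<^esub> (M', f') = (M * M', \<lambda>i\<in>{1..t}. f i * f' i)"
  "(M, f) \<oplus>\<^bsub>block_algebra n t\<^esub> (M', f') = (M + M', \<lambda>i\<in>{1..t}. f i + f' i)"
  "c \<odot>\<^bsub>block_algebra n t\<^esub> (M, f) = (c \<cdot>\<^sub>m M, \<lambda>i\<in>{1..t}. c * f i)"
  "\<one>\<^bsub>block_algebra n t\<^esub> = (1\<^sub>m n, \<lambda>i\<in>{1..t}. 1)"
  by (simp_all add: block_algebra_def alg_direct_sum_def full_matrix_algebra_def module_mat_def
      alg_direct_sum_family_def complex_algebra_def)

section \<open>Algebras spanned by matrix units and orthogonal idempotents\<close>

text \<open>The multiplication table of a full matrix algebra of size \<open>n\<close> plus one copy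
  of the scalars for each element of \<open>K\<close>. Nonvanishing gives linear independence, and
  \<open>one_decomp\<close> places the identity in the span. \<open>K\<close> is any finite set of
  indices, so that it can later consist of the \<open>i\<close> with nonzero remainder.\<close>

locale matrix_unit_system =
  fixes n :: nat and U :: "nat \<Rightarrow> nat \<Rightarrow> complex^'x^'x::finite"
    and K :: "nat set" and Q :: "nat \<Rightarrow> complex^'x^'x"
  assumes finite_K: "finite K"
    and U_mult_U: "\<And>i j k l. \<lbrakk>i < n; j < n; k < n; l < n\<rbrakk> \<Longrightarrow>
      U i j ** U k l = (if j = k then U i l else 0)"
    and Q_mult_Q: "\<And>k k'. \<lbrakk>k \<in> K; k' \<in> K\<rbrakk> \<Longrightarrow> Q k ** Q k' = (if k = k' then Q k else 0)"
    and U_mult_Q: "\<And>i j k. \<lbrakk>i < n; j < n; k \<in> K\<rbrakk> \<Longrightarrow> U i j ** Q k = 0"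
    and Q_mult_U: "\<And>i j k. \<lbrakk>i < n; j < n; k \<in> K\<rbrakk> \<Longrightarrow> Q k ** U i j = 0"
    and U_nonzero: "\<And>i j. \<lbrakk>i < n; j < n\<rbrakk> \<Longrightarrow> U i j \<noteq> 0"
    and Q_nonzero: "\<And>k. k \<in> K \<Longrightarrow> Q k \<noteq> 0"
    and one_decomp: "(\<Sum>i<n. U i i) + (\<Sum>k\<in>K. Q k) = Finite_Cartesian_Product.mat 1"
begin

text \<open>The matrix with coordinates \<open>a\<close> and \<open>f\<close>. Only values of
  \<open>a\<close> at indices below \<open>n\<close> and of \<open>f\<close> on \<open>K\<close>
  enter, hence the restricted ranges in \<open>comb_cong\<close> and
  \<open>comb_inject\<close>.\<close>

definition comb :: "(nat \<Rightarrow> nat \<Rightarrow> complex) \<Rightarrow> (nat \<Rightarrow> complex) \<Rightarrow> complex^'x^'x" where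
  "comb a f = (\<Sum>i<n. \<Sum>j<n. mat_scale (a i j) (U i j)) + (\<Sum>k\<in>K. mat_scale (f k) (Q k))"

definition units :: "(complex^'x^'x) set" where
  "units = {U i j | i j. i < n \<and> j < n} \<union> Q ` K"

lemma comb_add: "comb a f + comb b g = comb (\<lambda>i j. a i j + b i j) (\<lambda>k. f k + g k)"
  by (simp add: comb_def cmat.scale_left_distrib sum.distrib)

lemma comb_scale: "mat_scale c (comb a f) = comb (\<lambda>i j. c * a i j) (\<lambda>k. c * f k)"
  by (simp add: comb_def cmat.scale_right_distrib cmat.scale_sum_right)

lemma comb_one: "comb (\<lambda>i j. if i = j then 1 else 0) (\<lambda>k. 1) = Finite_Cartesian_Product.mat 1"
  by (simp add: comb_def mat_scale_if one_decomp)

lemma comb_cong: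
  assumes "\<And>i j. \<lbrakk>i < n; j < n\<rbrakk> \<Longrightarrow> a i j = b i j" "\<And>k. k \<in> K \<Longrightarrow> f k = g k"
  shows "comb a f = comb b g"
  unfolding comb_def using assms by (intro arg_cong2[where f="(+)"] sum.cong) auto

lemma U_mult_comb:
  assumes "i < n" "j < n"
  shows "U i j ** comb b g = (\<Sum>l<n. mat_scale (b j l) (U i l))"
proof -
  have "U i j ** comb b g = (\<Sum>k<n. \<Sum>l<n. if k = j then mat_scale (b k l) (U i l) else 0)"
    using assms
    by (auto simp: comb_def matrix_add_ldistrib matrix_sum_mult_right U_mult_U U_mult_Q
        intro!: sum.cong)
  also have "\<dots> = (\<Sum>k<n. if k = j then (\<Sum>l<n. mat_scale (b k l) (U i l)) else 0)"
    by (intro sum.cong) auto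
  also have "\<dots> = (\<Sum>l<n. mat_scale (b j l) (U i l))"
    using assms by simp
  finally show ?thesis .
qed

lemma Q_mult_comb:
  assumes "k \<in> K"
  shows "Q k ** comb b g = mat_scale (g k) (Q k)"
proof -
  have "Q k ** comb b g = (\<Sum>k'\<in>K. if k' = k then mat_scale (g k') (Q k) else 0)"
    using assms
    by (auto simp: comb_def matrix_add_ldistrib matrix_sum_mult_right Q_mult_U Q_mult_Q
        intro!: sum.cong)
  then show ?thesis
    using assms finite_K by simp
qed

lemma comb_mult: "comb a f ** comb b g = comb (\<lambda>i l. \<Sum>j<n. a i j * b j l) (\<lambda>k. f k * g k)"
proof -
  have "comb a f ** comb b g =
      (\<Sum>i<n. \<Sum>j<n. \<Sum>l<n. mat_scale (a i j * b j l) (U i l)) +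
      (\<Sum>k\<in>K. mat_scale (f k * g k) (Q k))"
    unfolding comb_def[of a f]
    by (simp add: matrix_add_mult_left matrix_sum_mult_left U_mult_comb Q_mult_comb
        cmat.scale_sum_right)
  also have "(\<Sum>i<n. \<Sum>j<n. \<Sum>l<n. mat_scale (a i j * b j l) (U i l)) =
      (\<Sum>i<n. \<Sum>l<n. mat_scale (\<Sum>j<n. a i j * b j l) (U i l))"
    \<comment> \<open>The product expands with \<open>j\<close> outside \<open>l\<close>, while
      collecting the coefficient of \<open>U i l\<close> needs \<open>j\<close> innermost.\<close>
    unfolding cmat.scale_sum_left by (rule sum.cong[OF refl], rule sum.swap)
  finally show ?thesis
    by (simp add: comb_def)
qed

text \<open>Multiplying by \<open>U i i\<close> on the left and \<open>U j j\<close> on the right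
  isolates the coefficient \<open>a i j\<close>; multiplying by \<open>Q k\<close> on the left
  isolates \<open>f k\<close>.\<close>

lemma comb_eq_zero:
  assumes "comb a f = 0"
  shows "\<And>i j. i < n \<Longrightarrow> j < n \<Longrightarrow> a i j = 0" "\<And>k. k \<in> K \<Longrightarrow> f k = 0"
proof -
  fix i j assume ij: "i < n" "j < n"
  have "0 = U i i ** comb a f ** U j j"
    by (simp add: assms)
  also have "\<dots> = (\<Sum>l<n. if l = j then mat_scale (a i l) (U i j) else 0)"
    using ij by (auto simp: U_mult_comb matrix_sum_mult_left U_mult_U mat_scale_if intro!: sum.cong)
  also have "\<dots> = mat_scale (a i j) (U i j)"
    using ij by simp
  finally show "a i j = 0"
    using U_nonzero[OF ij] by (metis cmat.scale_eq_0_iff)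
next
  fix k assume k: "k \<in> K"
  have "mat_scale (f k) (Q k) = 0"
    using Q_mult_comb[OF k, of a f] by (simp add: assms)
  then show "f k = 0"
    using Q_nonzero[OF k] by (metis cmat.scale_eq_0_iff)
qed

lemma comb_inject:
  assumes "comb a f = comb b g"
  shows "\<And>i j. i < n \<Longrightarrow> j < n \<Longrightarrow> a i j = b i j" "\<And>k. k \<in> K \<Longrightarrow> f k = g k"
proof -
  have "comb (\<lambda>i j. a i j + (-1) * b i j) (\<lambda>k. f k + (-1) * g k) = 0"
    using assms unfolding comb_add[symmetric] comb_scale[symmetric] by simp
  from comb_eq_zero[OF this]
  show "\<And>i j. i < n \<Longrightarrow> j < n \<Longrightarrow> a i j = b i j" "\<And>k. k \<in> K \<Longrightarrow> f k = g k"
    by auto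
qed

lemma comb_in_span: "comb a f \<in> cmat.span units"
  unfolding comb_def units_def
  by (intro cmat.span_add cmat.span_sum cmat.span_scale) (auto intro: cmat.span_base)

lemma U_eq_comb:
  assumes "i < n" "j < n"
  shows "U i j = comb (\<lambda>k l. if k = i \<and> l = j then 1 else 0) (\<lambda>k. 0)"
proof -
  have "(\<Sum>k<n. \<Sum>l<n. mat_scale (if k = i \<and> l = j then 1 else 0) (U k l)) =
      (\<Sum>k<n. if k = i then (\<Sum>l<n. if l = j then U k l else 0) else 0)"
    by (intro sum.cong refl) (auto simp: mat_scale_if intro!: sum.cong)
  then show ?thesis
    using assms by (simp add: comb_def)
qed

lemma Q_eq_comb:
  assumes "k \<in> K"
  shows "Q k = comb (\<lambda>i j. 0) (\<lambda>k'. if k' = k then 1 else 0)"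
  using assms finite_K
  by (simp add: comb_def mat_scale_if)

text \<open>Gives every element of the span coordinates: the matrices of the form
  \<open>comb a f\<close> form a subspace containing all units.\<close>

lemma span_units: "cmat.span units = range (\<lambda>(a, f). comb a f)"
proof
  have range: "comb a f \<in> range (\<lambda>(a, f). comb a f)" for a f
    by (rule range_eqI[where x = "(a, f)"]) simp
  have "cmat.subspace (range (\<lambda>(a, f). comb a f))"
  proof (rule cmat.subspaceI)
    have "comb (\<lambda>i j. 0) (\<lambda>k. 0) = 0"
      by (simp add: comb_def)
    then show "0 \<in> range (\<lambda>(a, f). comb a f)"
      using range by metis
  qed (auto simp: comb_add comb_scale simp del: split_paired_Ex intro!: range[simplified])
  moreover have "units \<subseteq> range (\<lambda>(a, f). comb a f)"
    using U_eq_comb Q_eq_comb range by (auto simp: units_def simp del: image_iff)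
  ultimately show "cmat.span units \<subseteq> range (\<lambda>(a, f). comb a f)"
    by (rule cmat.span_minimal[rotated])
qed (auto simp: comb_in_span)

lemma unital_subalgebra_span: "unital_subalgebra (cmat.span units)"
  unfolding unital_subalgebra_def
proof (intro conjI ballI)
  show "Finite_Cartesian_Product.mat 1 \<in> cmat.span units"
    unfolding comb_one[symmetric] by (rule comb_in_span)
  fix M N assume "M \<in> cmat.span units" "N \<in> cmat.span units"
  then obtain a f b g where "M = comb a f" "N = comb b g"
    by (auto simp: span_units)
  then show "M ** N \<in> cmat.span units"
    by (simp add: comb_mult comb_in_span)
qed (rule cmat.subspace_span)

lemma dim_span_units: "cmat.dim (cmat.span units) = n\<^sup>2 + card K"
proof -
  \<comment> \<open>\<open>units\<close> is a set of matrices, so counting it requires that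
    different indices give different elements.\<close>
  have U_U: "i = i' \<and> j = j'" if "U i j = U i' j'" "i < n" "j < n" "i' < n" "j' < n" for i j i' j'
    using comb_inject(1)[OF that(1)[unfolded U_eq_comb[OF that(2,3)] U_eq_comb[OF that(4,5)]],
        of i j] that by (auto split: if_splits)
  have Q_Q: "k = k'" if "Q k = Q k'" "k \<in> K" "k' \<in> K" for k k'
    using Q_mult_Q[of k k'] Q_mult_Q[of k k] Q_nonzero[of k] that by (auto split: if_splits)
  have U_Q: "U i j \<noteq> Q k" if "i < n" "j < n" "k \<in> K" for i j k
    using U_mult_Q[OF that] Q_mult_Q[of k k] Q_nonzero[of k] that by auto
  let ?u = "\<lambda>(i, j). U i j"
  have eq: "units = ?u ` ({..<n} \<times> {..<n}) \<union> Q ` K"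
    by (auto simp: units_def)
  have inj: "inj_on ?u ({..<n} \<times> {..<n})" "inj_on Q K"
    using U_U Q_Q by (auto simp: inj_on_def)
  have disj: "?u ` ({..<n} \<times> {..<n}) \<inter> Q ` K = {}"
    using U_Q by fastforce
  have fin: "finite units"
    by (simp add: eq finite_K)
  have "cmat.independent units"
  proof
    assume "cmat.dependent units"
    then obtain c w where w: "w \<in> units" "c w \<noteq> 0" and zero: "(\<Sum>v\<in>units. mat_scale (c v) v) = 0"
      using cmat.dependent_finite[OF fin] by auto
    \<comment> \<open>The linear relation is indexed by matrices; reindexing it by their labels
      turns it into a vanishing \<open>comb\<close>.\<close>
    have "(\<Sum>v\<in>units. mat_scale (c v) v) =
        (\<Sum>v\<in>?u ` ({..<n} \<times> {..<n}). mat_scale (c v) v) + (\<Sum>v\<in>Q ` K. mat_scale (c v) v)"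
      unfolding eq by (rule sum.union_disjoint) (simp_all add: finite_K disj)
    also have "(\<Sum>v\<in>?u ` ({..<n} \<times> {..<n}). mat_scale (c v) v) =
        (\<Sum>i<n. \<Sum>j<n. mat_scale (c (U i j)) (U i j))"
      unfolding sum.reindex[OF inj(1)] sum.cartesian_product by (simp add: split_def)
    also have "(\<Sum>v\<in>Q ` K. mat_scale (c v) v) = (\<Sum>k\<in>K. mat_scale (c (Q k)) (Q k))"
      by (simp add: sum.reindex[OF inj(2)])
    finally have "comb (\<lambda>i j. c (U i j)) (\<lambda>k. c (Q k)) = 0"
      using zero by (simp add: comb_def)
    from comb_eq_zero[OF this] w show False
      by (auto simp: units_def)
  qed
  moreover have "card units = n\<^sup>2 + card K"
    unfolding eq by (subst card_Un_disjoint)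
      (simp_all add: finite_K disj card_image[OF inj(1)] card_image[OF inj(2)] card_cartesian_product
        power2_eq_square)
  ultimately show ?thesis
    by (simp add: cmat.dim_eq_card_independent)
qed

lemma alg_isomorphic_span_units:
  "alg_isomorphic (subalgebra_of_cmat (cmat.span units)) (block_algebra n (card K))"
proof -
  define t where "t = card K"
  \<comment> \<open>\<sigma> renumbers \<open>K\<close> by \<open>{1..t}\<close>, the index set of
    the scalar summands.\<close>
  obtain \<sigma> where \<sigma>: "bij_betw \<sigma> K {1..t}"
    using finite_K by (metis t_def bij_betw_iff_card card_atLeastAtMost diff_Suc_1
        finite_atLeastAtMost)
  let ?A = "subalgebra_of_cmat (cmat.span units)" and ?B = "block_algebra n t"
  let ?h = "\<lambda>(M, f). comb (\<lambda>i j. M $$ (i, j)) (\<lambda>k. f (\<sigma> k))"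
  have A: "carrier ?A = cmat.span units" "mult ?A = (**)" "one ?A = Finite_Cartesian_Product.mat 1"
    "add ?A = (+)" "smult ?A = mat_scale"
    by (simp_all add: subalgebra_of_cmat_def)
  have \<sigma>_in: "\<sigma> k \<in> {1..t}" if "k \<in> K" for k
    using \<sigma> that by (rule bij_betw_apply)
  have "bij_betw ?h (carrier ?B) (carrier ?A)"
  proof (rule bij_betwI')
    fix x y assume xy: "x \<in> carrier ?B" "y \<in> carrier ?B"
    obtain M f N g where eqs: "x = (M, f)" "y = (N, g)"
      by fastforce
    have mem: "M \<in> carrier_mat n n" "N \<in> carrier_mat n n" "f \<in> {1..t} \<rightarrow>\<^sub>E UNIV" "g \<in> {1..t} \<rightarrow>\<^sub>E UNIV"
      using xy by (auto simp: eqs carrier_block_algebra)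
    show "?h x = ?h y \<longleftrightarrow> x = y"
    proof
      assume "?h x = ?h y"
      then have eq: "comb (\<lambda>i j. M $$ (i, j)) (\<lambda>k. f (\<sigma> k)) = comb (\<lambda>i j. N $$ (i, j)) (\<lambda>k. g (\<sigma> k))"
        by (simp add: eqs)
      have "M = N"
        using comb_inject(1)[OF eq] mem by (intro eq_matI) auto
      moreover have "f = g"
      proof (rule PiE_ext[OF mem(3,4)])
        fix s assume "s \<in> {1..t}"
        then obtain k where "k \<in> K" "s = \<sigma> k"
          using \<sigma> by (metis bij_betw_def imageE)
        then show "f s = g s"
          using comb_inject(2)[OF eq] by simp
      qed
      ultimately show "x = y"
        by (simp add: eqs)
    qed simp
  next
    fix x assume "x \<in> carrier ?B"
    then show "?h x \<in> carrier ?A"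
      by (auto simp: A comb_in_span split_def)
  next
    fix T assume "T \<in> carrier ?A"
    then have "T \<in> cmat.span units"
      by (simp only: A)
    then obtain a f where T: "T = comb a f"
      unfolding span_units by auto
    \<comment> \<open>The preimage of \<open>comb a f\<close>: the scalar coordinates are pulled
      back along \<sigma> and restricted to \<open>{1..t}\<close>, as membership in the carrier
      demands.\<close>
    let ?x = "(Matrix.mat n n (\<lambda>(i, j). a i j), \<lambda>s\<in>{1..t}. f (inv_into K \<sigma> s))"
    have "?h ?x = comb a f"
      using \<sigma>_in \<sigma> by (auto intro!: comb_cong simp: bij_betw_inv_into_left)
    moreover have "?x \<in> carrier ?B"
      by (simp add: carrier_block_algebra)
    ultimately show "\<exists>x\<in>carrier ?B. T = ?h x"
      using T by metis
  qed
  then have "inv_into (carrier ?B) ?h \<in> alg_iso ?A ?B"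
  proof (rule alg_iso_inv_into)
    show "?h \<one>\<^bsub>?B\<^esub> = \<one>\<^bsub>?A\<^esub>"
      unfolding A comb_one[symmetric] block_algebra_simps using \<sigma>_in
      by (auto intro!: comb_cong)
    fix x y assume "x \<in> carrier ?B" "y \<in> carrier ?B"
    then show "?h (x \<otimes>\<^bsub>?B\<^esub> y) = ?h x \<otimes>\<^bsub>?A\<^esub> ?h y" "?h (x \<oplus>\<^bsub>?B\<^esub> y) = ?h x \<oplus>\<^bsub>?A\<^esub> ?h y"
      using \<sigma>_in
      by (auto simp: carrier_block_algebra block_algebra_simps A comb_mult comb_add scalar_prod_def
          lessThan_atLeast0 intro!: comb_cong)
  next
    fix c x assume "x \<in> carrier ?B"
    then show "?h (c \<odot>\<^bsub>?B\<^esub> x) = c \<odot>\<^bsub>?A\<^esub> ?h x"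
      using \<sigma>_in
      by (auto simp: carrier_block_algebra block_algebra_simps A comb_scale intro!: comb_cong)
  qed (auto simp: carrier_block_algebra block_algebra_simps)
  then show ?thesis
    unfolding alg_isomorphic_def t_def by blast
qed

end

section \<open>Polynomials of self-adjoint matrices\<close>

definition herm :: "complex^'x \<Rightarrow> complex^'x::finite \<Rightarrow> complex" where
  "herm v w = (\<Sum>i\<in>UNIV. v $ i * cnj (w $ i))"

lemma herm_self_eq_0_iff [simp]: "herm v v = 0 \<longleftrightarrow> v = 0"
proof -
  have "herm v v = of_real (\<Sum>i\<in>UNIV. (cmod (v $ i))\<^sup>2)"
    by (simp add: herm_def complex_norm_square[symmetric] del: of_real_power)
  then show ?thesis
    by (simp add: sum_nonneg_eq_0_iff Finite_Cartesian_Product.vec_eq_iff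
        del: of_real_sum of_real_power)
qed

lemma herm_scale [simp]: "herm (c *s v) w = c * herm v w" "herm v (c *s w) = cnj c * herm v w"
  by (simp_all add: herm_def sum_distrib_left mult_ac)

lemma herm_zero [simp]: "herm 0 w = 0" "herm v 0 = 0"
  by (simp_all add: herm_def)

lemma herm_diff_left: "herm (u - v) w = herm u w - herm v w"
  by (simp add: herm_def left_diff_distrib sum_subtractf)

lemma herm_diff_right: "herm u (v - w) = herm u v - herm u w"
  by (simp add: herm_def right_diff_distrib sum_subtractf)

lemma herm_sum_right: "herm v (sum f I) = (\<Sum>k\<in>I. herm v (f k))"
  unfolding herm_def by (subst sum.swap) (simp add: sum_distrib_left)

lemma herm_axis: "herm v (axis x 1) = v $ x"
  by (simp add: herm_def axis_def if_distrib[of cnj] if_distrib[of "\<lambda>c. _ * c"] cong: if_cong)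

definition self_adjoint :: "complex^'x^'x::finite \<Rightarrow> bool" where
  "self_adjoint A \<longleftrightarrow> (\<forall>v w. herm (A *v v) w = herm v (A *v w))"

lemma self_adjoint_eigenvalue_real:
  assumes "self_adjoint A" "c \<in> eigenvalues A"
  shows "cnj c = c"
proof -
  obtain v where v: "v \<noteq> 0" "A *v v = c *s v"
    using assms(2) by (auto simp: eigenvalues_def)
  have "herm (A *v v) v = herm v (A *v v)"
    using assms(1) by (simp add: self_adjoint_def)
  then have "c * herm v v = cnj c * herm v v"
    by (simp add: v)
  then show ?thesis
    using v(1) by simp
qed

lemma self_adjoint_eigenvectors_orthogonal:
  assumes "self_adjoint A" "A *v v = c *s v" "A *v w = d *s w" "cnj d = d" "c \<noteq> d"
  shows "herm v w = 0"
proof -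
  have "herm (A *v v) w = herm v (A *v w)"
    using assms(1) by (simp add: self_adjoint_def)
  then have "c * herm v w = d * herm v w"
    by (simp add: assms)
  then show ?thesis
    using assms(5) by simp
qed

section \<open>Evaluation of polynomials at a matrix, by Horner's scheme\<close>

definition matrix_poly :: "complex^'x^'x \<Rightarrow> complex poly \<Rightarrow> complex^'x^'x::finite" where
  "matrix_poly A p =
     fold_coeffs (\<lambda>a M. mat_scale a (Finite_Cartesian_Product.mat 1) + A ** M) p 0"

lemma matrix_poly_0 [simp]: "matrix_poly A 0 = 0"
  by (simp add: matrix_poly_def)

lemma matrix_poly_pCons [simp]:
  "matrix_poly A (pCons a p) =
     mat_scale a (Finite_Cartesian_Product.mat 1) + A ** matrix_poly A p"
  by (cases "p = 0 \<and> a = 0") (auto simp: matrix_poly_def)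

lemma matrix_poly_1 [simp]: "matrix_poly A 1 = Finite_Cartesian_Product.mat 1"
  by (simp add: one_pCons)

lemma matrix_poly_add: "matrix_poly A (p + q) = matrix_poly A p + matrix_poly A q"
  by (induction p q rule: poly_induct2)
    (simp_all add: matrix_add_ldistrib cmat.scale_left_distrib algebra_simps)

lemma matrix_poly_smult: "matrix_poly A (Polynomial.smult c p) = mat_scale c (matrix_poly A p)"
  by (induction p) (simp_all add: cmat.scale_right_distrib)

lemma matrix_poly_diff: "matrix_poly A (p - q) = matrix_poly A p - matrix_poly A q"
proof -
  have "p - q = p + Polynomial.smult (- 1) q"
    by simp
  then show ?thesis
    by (simp only: matrix_poly_add matrix_poly_smult) simp
qed

lemma matrix_poly_mult: "matrix_poly A (p * q) = matrix_poly A p ** matrix_poly A q"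
  by (induction p)
    (simp_all add: matrix_poly_add matrix_poly_smult matrix_add_mult_left matrix_mul_assoc)

lemma matrix_poly_sum: "matrix_poly A (sum f I) = (\<Sum>i\<in>I. matrix_poly A (f i))"
  by (induction I rule: infinite_finite_induct) (simp_all add: matrix_poly_add)

text \<open>Lets an entry of a polynomial in \<open>A\<close> be read off from the entries of the
  powers of \<open>A\<close>.\<close>

lemma matrix_poly_monom_sum:
  "matrix_poly A p = (\<Sum>k\<le>degree p. mat_scale (coeff p k) (matrix_poly A (monom 1 k)))"
proof -
  have "matrix_poly A p = matrix_poly A (\<Sum>k\<le>degree p. Polynomial.smult (coeff p k) (monom 1 k))"
    by (simp add: smult_monom poly_as_sum_of_monoms)
  then show ?thesis
    by (simp add: matrix_poly_sum matrix_poly_smult)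
qed

lemma matrix_poly_eigenvector:
  assumes "A *v v = c *s v"
  shows "matrix_poly A p *v v = poly p c *s v"
proof (induction p)
  case (pCons a p)
  then show ?case
    using assms
    by (simp add: matrix_vector_mult_add_rdistrib flip: matrix_vector_mul_assoc)
      (simp add: vec.scale_left_distrib vec.scale mult.commute)
qed simp

lemma matrix_poly_in_subalgebra:
  assumes "unital_subalgebra S" "A \<in> S"
  shows "matrix_poly A p \<in> S"
proof (induction p)
  case 0
  then show ?case
    using assms by (simp add: unital_subalgebra_def cmat.subspace_0)
next
  case (pCons a p)
  then show ?case
    using assms by (simp add: unital_subalgebra_def cmat.subspace_add cmat.subspace_scale)
qed

text \<open>The \<open>CARD('x) + 1\<close> vectors obtained from \<open>v\<close> by the powers of
  \<open>A\<close> up to \<open>CARD('x)\<close> exceed the dimension. If they are distinct, a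
  linear relation supplies the coefficients of \<open>q\<close>; if two coincide, the difference of
  two monomials serves.\<close>

lemma ex_annihilating_poly:
  fixes A :: "complex^'x^'x::finite"
  shows "\<exists>q. q \<noteq> 0 \<and> matrix_poly A q *v v = 0"
proof -
  define f where "f k = matrix_poly A (monom 1 k) *v v" for k
  define I where "I = {..CARD('x)}"
  show ?thesis
  proof (cases "inj_on f I")
    case True
    then have "card (f ` I) = Suc CARD('x)"
      by (simp add: card_image I_def)
    moreover have "vec.dim (f ` I) \<le> CARD('x)"
      by (rule dim_subset_UNIV_cart_gen)
    ultimately have "vec.dependent (f ` I)"
      using vec.dim_eq_card_independent[of "f ` I"] by auto
    then obtain u w where w: "w \<in> f ` I" "u w \<noteq> 0" and zero: "(\<Sum>w\<in>f ` I. u w *s w) = 0"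
      using vec.dependent_finite[of "f ` I"] by (auto simp: I_def)
    define q where "q = (\<Sum>k\<in>I. Polynomial.smult (u (f k)) (monom 1 k))"
    have "matrix_poly A q *v v = (\<Sum>k\<in>I. u (f k) *s f k)"
      by (simp add: q_def f_def matrix_poly_sum matrix_poly_smult matrix_sum_mult_vec)
    also have "\<dots> = 0"
      using zero by (simp add: sum.reindex[OF True])
    finally have "matrix_poly A q *v v = 0" .
    moreover obtain k where "k \<in> I" "w = f k"
      using w by auto
    then have "coeff q k = u w"
      by (simp add: q_def coeff_sum smult_monom I_def)
    then have "q \<noteq> 0"
      using w by auto
    ultimately show ?thesis
      by blast
  next
    case False
    then obtain i j where ij: "f i = f j" "i \<noteq> j"
      by (auto simp: inj_on_def)
    have "monom (1::complex) i - monom 1 j \<noteq> 0"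
      using ij by (metis coeff_diff coeff_0 coeff_monom diff_zero zero_neq_one)
    moreover have "matrix_poly A (monom 1 i - monom 1 j) *v v = 0"
      using ij by (simp add: matrix_poly_diff matrix_vector_mult_diff_rdistrib f_def)
    ultimately show ?thesis
      by blast
  qed
qed

text \<open>Take a nonzero \<open>q\<close> of least degree with \<open>q(A)v = 0\<close> and split
  off a root, \<open>q = (X - c) r\<close>. Minimality makes \<open>r(A)v\<close> nonzero, and
  \<open>A - c\<close> kills it. That the eigenvector is a polynomial in \<open>A\<close> applied to
  \<open>v\<close> matters later.\<close>

lemma ex_eigenvector_matrix_poly:
  fixes A :: "complex^'x^'x::finite"
  assumes "v \<noteq> 0"
  shows "\<exists>r c. matrix_poly A r *v v \<noteq> 0 \<and> A *v (matrix_poly A r *v v) = c *s (matrix_poly A r *v v)"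
proof -
  define Z where "Z q \<longleftrightarrow> q \<noteq> 0 \<and> matrix_poly A q *v v = 0" for q
  obtain q where q: "Z q" and min: "\<And>r. Z r \<Longrightarrow> degree q \<le> degree r"
    using ex_annihilating_poly[of A v] ex_has_least_nat[of Z _ degree] unfolding Z_def by metis
  have "degree q \<noteq> 0"
  proof
    assume "degree q = 0"
    then obtain a where "q = [:a:]"
      by (rule degree_eq_zeroE)
    then show False
      using q assms by (simp add: Z_def)
  qed
  then obtain c where "poly q c = 0"
    using fundamental_theorem_of_algebra constant_degree by metis
  then obtain r where r: "q = [:- c, 1:] * r"
    by (auto simp: poly_eq_0_iff_dvd)
  have "r \<noteq> 0"
    using q r by (auto simp: Z_def)
  then have "degree r < degree q"
    unfolding r by (subst degree_mult_eq) auto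
  then have "\<not> Z r"
    using min by fastforce
  then have "matrix_poly A r *v v \<noteq> 0"
    using \<open>r \<noteq> 0\<close> by (simp add: Z_def)
  moreover have "A *v (matrix_poly A r *v v) = c *s (matrix_poly A r *v v)"
    using q unfolding Z_def r
    by (simp add: matrix_poly_diff matrix_poly_smult matrix_vector_mult_add_rdistrib
        matrix_vector_mult_diff_rdistrib matrix_vector_mul_assoc)
  ultimately show ?thesis
    by blast
qed

text \<open>For \<open>u = (A - c)v\<close>, self-adjointness of \<open>A - c\<close> gives
  \<open>herm u u = herm v ((A - c)u) = 0\<close>.\<close>

lemma self_adjoint_kernel_square:
  assumes A: "self_adjoint A" and c: "cnj c = c"
    and v: "matrix_poly A ([:- c, 1:] * [:- c, 1:]) *v v = 0"
  shows "matrix_poly A [:- c, 1:] *v v = 0"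
proof -
  have shift: "matrix_poly A [:- c, 1:] *v u = A *v u - c *s u" for u
    by (simp add: matrix_vector_mult_diff_rdistrib)
  have sym: "herm (A *v u - c *s u) w = herm u (A *v w - c *s w)" for u w
    using A c by (simp add: herm_diff_left herm_diff_right self_adjoint_def)
  let ?u = "matrix_poly A [:- c, 1:] *v v"
  have "matrix_poly A [:- c, 1:] *v ?u = 0"
    using v by (simp only: matrix_poly_mult matrix_vector_mul_assoc)
  then have "herm ?u ?u = 0"
    unfolding shift sym by simp
  then show ?thesis
    by simp
qed

text \<open>
  If \<open>p(A)u \<noteq> 0\<close>, the \<open>A\<close>-invariant subspace generated by it contains an eigenvector
  \<open>r(A)p(A)u\<close>. Its eigenvalue \<open>c\<close> is a root of \<open>p\<close>, so this eigenvector is \<open>(A - c)z\<close> for some \<open>z\<close>,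
  and then \<open>(A - c)\<^sup>2z = 0\<close> forces \<open>(A - c)z = 0\<close> because \<open>A - c\<close> is self-adjoint.
\<close>

lemma matrix_poly_eq_0_spectrum:
  assumes A: "self_adjoint A" and p: "\<And>c. c \<in> eigenvalues A \<Longrightarrow> poly p c = 0"
  shows "matrix_poly A p = 0"
proof (rule ccontr)
  assume "matrix_poly A p \<noteq> 0"
  then obtain u where "matrix_poly A p *v u \<noteq> 0"
    by (metis matrix_eq matrix_vector_mult_0)
  from ex_eigenvector_matrix_poly[OF this, of A] obtain r c
    where nz: "matrix_poly A r *v (matrix_poly A p *v u) \<noteq> 0"
      and eig: "A *v (matrix_poly A r *v (matrix_poly A p *v u)) =
        c *s (matrix_poly A r *v (matrix_poly A p *v u))"
    by blast
  let ?v = "matrix_poly A r *v (matrix_poly A p *v u)"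
  have c: "c \<in> eigenvalues A"
    using nz eig by (auto simp: eigenvalues_def)
  then have real: "cnj c = c"
    by (rule self_adjoint_eigenvalue_real[OF A])
  obtain s where s: "p = [:- c, 1:] * s"
    using p[OF c] by (auto simp: poly_eq_0_iff_dvd)
  have v: "?v = matrix_poly A [:- c, 1:] *v (matrix_poly A (r * s) *v u)"
    by (simp only: s matrix_vector_mul_assoc mult_ac flip: matrix_poly_mult)
  have "matrix_poly A [:- c, 1:] *v ?v = 0"
    using matrix_poly_eigenvector[OF eig, of "[:- c, 1:]"] by simp
  then have "matrix_poly A ([:- c, 1:] * [:- c, 1:]) *v (matrix_poly A (r * s) *v u) = 0"
    unfolding v by (simp only: matrix_poly_mult matrix_vector_mul_assoc matrix_mul_assoc)
  then show False
    using self_adjoint_kernel_square[OF A real] nz v by metis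
qed

section \<open>Matrix units from the spectral projections\<close>

lemma mult_base_matrix_nth:
  "(M ** base_matrix x0) $ i $ j = (if j = x0 then M $ i $ x0 else 0)"
  by (simp add: matrix_matrix_mult_def base_matrix_def if_distrib[of "\<lambda>c. _ * c"] cong: if_cong)

lemma base_matrix_mult_nth:
  "(base_matrix x0 ** M) $ i $ j = (if i = x0 then M $ x0 $ j else 0)"
  by (simp add: matrix_matrix_mult_def base_matrix_def if_distrib[of "\<lambda>c. c * _"] cong: if_cong)

lemma base_matrix_mult_mult:
  "base_matrix x0 ** M ** base_matrix x0 = mat_scale (M $ x0 $ x0) (base_matrix x0)"
  by (simp add: Finite_Cartesian_Product.vec_eq_iff mult_base_matrix_nth base_matrix_mult_nth)
    (simp add: base_matrix_def)

lemma base_matrix_mult_vec: "base_matrix x0 *v v = (v $ x0) *s axis x0 1"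
  by (simp add: Finite_Cartesian_Product.vec_eq_iff matrix_vector_mult_def base_matrix_def axis_def
      if_distrib[of "\<lambda>c. c * _"] cong: if_cong)

lemma mult_base_matrix_mult_nth:
  "(M ** base_matrix x0 ** N) $ i $ j = M $ i $ x0 * N $ x0 $ j"
  unfolding matrix_matrix_mult_def[of "M ** base_matrix x0"]
  by (simp add: mult_base_matrix_nth if_distrib[of "\<lambda>c. c * _"] cong: if_cong)

lemma mult_axis_nth: "(M *v axis x 1) $ y = M $ y $ x"
  by (simp add: matrix_vector_mult_def axis_def if_distrib[of "\<lambda>c. _ * c"] cong: if_cong)

text \<open>
  The entry conditions at \<open>y0\<close> say that \<open>A\<^sup>D e\<close> is not in the span of \<open>e, \<dots>, A\<^sup>D\<^sup>-\<^sup>1 e\<close>, where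
  \<open>e\<close> is the basis vector of \<open>x0\<close>: every eigenspace then contributes to \<open>e\<close>.
\<close>

locale spectral_base =
  fixes A :: "complex^'x^'x::finite" and x0 y0 :: 'x and D :: nat and l :: "nat \<Rightarrow> complex"
  assumes A: "self_adjoint A"
    and l: "bij_betw l {0..D} (eigenvalues A)"
    and entry_less: "\<And>k. k < D \<Longrightarrow> matrix_poly A (monom 1 k) $ y0 $ x0 = 0"
    and entry_D: "matrix_poly A (monom 1 D) $ y0 $ x0 \<noteq> 0"
begin

definition n :: nat where "n = Suc D"

lemma l_eq_iff: "i < n \<Longrightarrow> j < n \<Longrightarrow> l i = l j \<longleftrightarrow> i = j"
  using l by (auto simp: bij_betw_def inj_on_def n_def)

lemma l_eigenvalue: "i < n \<Longrightarrow> l i \<in> eigenvalues A"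
  using l by (auto simp: n_def intro: bij_betw_apply)

text \<open>The difference of the polynomials vanishes on the spectrum. Identities between the
  spectral projections thereby reduce to comparing values at the \<open>l i\<close>.\<close>

lemma matrix_poly_cong:
  assumes "\<And>i. i < n \<Longrightarrow> poly p (l i) = poly q (l i)"
  shows "matrix_poly A p = matrix_poly A q"
proof -
  have "poly (p - q) c = 0" if c: "c \<in> eigenvalues A" for c
  proof -
    obtain i where "i < n" "c = l i"
      using l c unfolding n_def by (metis bij_betw_def imageE atLeastAtMost_iff less_Suc_eq_le)
    then show ?thesis
      using assms by simp
  qed
  then have "matrix_poly A (p - q) = 0"
    by (rule matrix_poly_eq_0_spectrum[OF A])
  then show ?thesis
    by (simp add: matrix_poly_diff)
qed

section \<open>Lagrange interpolation and the spectral projections\<close>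

definition lagrange :: "nat \<Rightarrow> complex poly" where
  "lagrange i = Polynomial.smult (inverse (\<Prod>j\<in>{..<n} - {i}. l i - l j))
     (\<Prod>j\<in>{..<n} - {i}. [:- l j, 1:])"

lemma poly_lagrange:
  assumes "i < n" "j < n"
  shows "poly (lagrange i) (l j) = (if i = j then 1 else 0)"
proof -
  have "(\<Prod>j\<in>{..<n} - {i}. l i - l j) \<noteq> 0"
    using assms l_eq_iff by (auto simp: prod_zero_iff)
  then show ?thesis
    using assms by (auto simp: lagrange_def poly_prod prod_zero_iff)
qed

text \<open>The exact degree matters: the coefficient at \<open>D\<close> is then the leading one,
  hence nonzero.\<close>

lemma degree_lagrange:
  assumes "i < n"
  shows "degree (lagrange i) = D"
proof -
  have "(\<Prod>j\<in>{..<n} - {i}. l i - l j) \<noteq> 0"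
    using assms l_eq_iff by (auto simp: prod_zero_iff)
  then show ?thesis
    using assms by (simp add: lagrange_def degree_prod_eq_sum_degree n_def)
qed

definition P :: "nat \<Rightarrow> complex^'x^'x" where
  "P i = matrix_poly A (lagrange i)"

lemma P_mult_P:
  assumes "i < n" "j < n"
  shows "P i ** P j = (if i = j then P i else 0)"
proof -
  have "P i ** P j = matrix_poly A (if i = j then lagrange i else 0)"
    unfolding P_def matrix_poly_mult[symmetric] using assms
    by (intro matrix_poly_cong) (auto simp: poly_lagrange)
  then show ?thesis
    by (simp add: P_def)
qed

lemma A_mult_P:
  assumes "i < n"
  shows "A ** P i = mat_scale (l i) (P i)"
proof -
  have "matrix_poly A (pCons 0 (lagrange i)) = matrix_poly A (Polynomial.smult (l i) (lagrange i))"
    using assms by (intro matrix_poly_cong) (auto simp: poly_lagrange)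
  then show ?thesis
    by (simp add: P_def matrix_poly_smult)
qed

lemma sum_P: "(\<Sum>i<n. P i) = Finite_Cartesian_Product.mat 1"
proof -
  have "matrix_poly A (\<Sum>i<n. lagrange i) = matrix_poly A 1"
    by (rule matrix_poly_cong) (simp add: poly_sum poly_lagrange)
  then show ?thesis
    by (simp add: matrix_poly_sum P_def)
qed

lemma A_eq_sum_P: "A = (\<Sum>i<n. mat_scale (l i) (P i))"
proof -
  have "A = A ** (\<Sum>i<n. P i)"
    by (simp add: sum_P)
  also have "\<dots> = (\<Sum>i<n. mat_scale (l i) (P i))"
    by (simp add: matrix_sum_mult_right A_mult_P del: matrix_mul_rid)
  finally show ?thesis .
qed

lemma P_eigenvector:
  assumes "i < n" "A *v v = l i *s v"
  shows "P i *v v = v"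
  using matrix_poly_eigenvector[OF assms(2)] assms(1) by (simp add: P_def poly_lagrange)

text \<open>The component of the basis vector of \<open>x0\<close> in the eigenspace of
  \<open>l i\<close>.\<close>

definition w :: "nat \<Rightarrow> complex^'x" where
  "w i = P i *v axis x0 1"

lemma A_mult_w: "i < n \<Longrightarrow> A *v w i = l i *s w i"
  by (simp add: w_def matrix_vector_mul_assoc A_mult_P)

text \<open>At \<open>y0\<close> the powers of \<open>A\<close> below \<open>D\<close> contribute
  nothing, so this coordinate of \<open>w i\<close> is the leading coefficient of
  \<open>lagrange i\<close> times a nonzero entry of the \<open>D\<close>-th power.\<close>

lemma w_nonzero:
  assumes "i < n"
  shows "w i \<noteq> 0"
proof -
  have "w i $ y0 = (\<Sum>k\<le>D. coeff (lagrange i) k * matrix_poly A (monom 1 k) $ y0 $ x0)"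
    unfolding w_def mult_axis_nth P_def
    by (subst matrix_poly_monom_sum) (simp add: degree_lagrange[OF assms])
  also have "\<dots> = coeff (lagrange i) D * matrix_poly A (monom 1 D) $ y0 $ x0"
    by (subst sum.remove[of _ D]) (auto intro!: sum.neutral entry_less)
  also have "\<dots> \<noteq> 0"
  proof -
    have "lagrange i \<noteq> 0"
      using poly_lagrange[OF assms assms] by auto
    then show ?thesis
      using entry_D degree_lagrange[OF assms] leading_coeff_0_iff[of "lagrange i"] by simp
  qed
  finally show ?thesis
    by auto
qed

definition c :: "nat \<Rightarrow> complex" where
  "c i = P i $ x0 $ x0"

text \<open>The basis vector of \<open>x0\<close> is the sum of the pairwise orthogonal
  \<open>w k\<close>, so pairing it with \<open>w i\<close> leaves only
  \<open>herm (w i) (w i)\<close>.\<close>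

lemma c_nonzero:
  assumes "i < n"
  shows "c i \<noteq> 0"
proof -
  have "axis x0 1 = (\<Sum>k<n. P k) *v axis x0 1"
    by (simp add: sum_P)
  also have "\<dots> = (\<Sum>k<n. w k)"
    by (simp add: w_def matrix_sum_mult_vec)
  finally have e: "axis x0 1 = (\<Sum>k<n. w k)" .
  have "c i = herm (w i) (axis x0 1)"
    by (simp add: herm_axis c_def w_def mult_axis_nth)
  also have "\<dots> = (\<Sum>k<n. herm (w i) (w k))"
    by (simp add: e herm_sum_right)
  also have "\<dots> = (\<Sum>k<n. if k = i then herm (w i) (w i) else 0)"
  proof (rule sum.cong)
    fix k assume "k \<in> {..<n}"
    then show "herm (w i) (w k) = (if k = i then herm (w i) (w i) else 0)"
      using self_adjoint_eigenvectors_orthogonal[OF A A_mult_w A_mult_w, of i k] assms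
        self_adjoint_eigenvalue_real[OF A l_eigenvalue, of k] l_eq_iff[of i k] by auto
  qed simp
  also have "\<dots> = herm (w i) (w i)"
    using assms by simp
  finally show ?thesis
    using w_nonzero[OF assms] by simp
qed

section \<open>Matrix units and the remainders of the projections\<close>

definition U :: "nat \<Rightarrow> nat \<Rightarrow> complex^'x^'x" where
  "U i j = mat_scale (inverse (c j)) (P i ** base_matrix x0 ** P j)"

text \<open>\<open>U i i\<close> projects onto the line of \<open>w i\<close>; \<open>Q i\<close> is
  what remains of the eigenprojection.\<close>

definition Q :: "nat \<Rightarrow> complex^'x^'x" where
  "Q i = P i - U i i"

text \<open>By \<open>eig_mult_gt_1_iff\<close> these are the indices of the multiple
  eigenvalues.\<close>

definition K :: "nat set" where
  "K = {i. i < n \<and> Q i \<noteq> 0}"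

lemma P_mult_U:
  assumes "i < n" "j < n" "k < n"
  shows "P i ** U j k = (if i = j then U i k else 0)"
  using assms by (simp add: U_def matrix_mul_assoc P_mult_P)

lemma U_mult_P:
  assumes "i < n" "j < n" "k < n"
  shows "U i j ** P k = (if j = k then U i j else 0)"
  using assms by (simp add: U_def matrix_mul_assoc[symmetric] P_mult_P)

text \<open>If \<open>j = k\<close>, the inner factor is the base matrix times \<open>c j\<close>,
  which cancels the scalar of \<open>U i j\<close>. Otherwise the orthogonal projections
  \<open>P j\<close> and \<open>P k\<close> meet in the middle.\<close>

lemma U_matrix_units:
  assumes "i < n" "j < n" "k < n" "h < n"
  shows "U i j ** U k h = (if j = k then U i h else 0)"
proof (cases "j = k")
  case True
  have "U i j ** U k h = mat_scale (inverse (c j) * inverse (c h))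
      (P i ** (base_matrix x0 ** (P j ** P j) ** base_matrix x0) ** P h)"
    by (simp add: U_def True matrix_mul_assoc mult.commute)
  also have "\<dots> = mat_scale (inverse (c j) * inverse (c h) * c j) (P i ** base_matrix x0 ** P h)"
    using assms by (simp add: P_mult_P base_matrix_mult_mult c_def)
  also have "\<dots> = U i h"
    using c_nonzero[of j] assms by (simp add: U_def)
  finally show ?thesis
    using True by simp
next
  case False
  have "U i j ** U k h = (U i j ** P j) ** U k h"
    using assms by (simp add: U_mult_P)
  also have "\<dots> = U i j ** (P j ** U k h)"
    by (simp add: matrix_mul_assoc)
  also have "\<dots> = 0"
    using assms False by (simp add: P_mult_U)
  finally show ?thesis
    using False by simp
qed

lemma Q_idempotents:
  assumes "i < n" "j < n"
  shows "Q i ** Q j = (if i = j then Q i else 0)"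
  using assms by (simp add: Q_def matrix_diff_mult P_mult_P P_mult_U U_mult_P U_matrix_units)

sublocale matrix_unit_system n U K Q
proof
  show "finite K"
    by (simp add: K_def)
  show "U i j \<noteq> 0" if "i < n" "j < n" for i j
  proof -
    \<comment> \<open>This entry of the unscaled product is \<open>c i * c j\<close>.\<close>
    have "U i j $ x0 $ x0 = c i"
      using c_nonzero[OF that(2)] by (simp add: U_def mult_base_matrix_mult_nth flip: c_def)
    then show ?thesis
      using c_nonzero[OF that(1)] by auto
  qed
  \<comment> \<open>Indices outside \<open>K\<close> contribute zero; over the full range the
    \<open>U i i\<close> cancel and the projections sum to the identity.\<close>
  have "(\<Sum>k\<in>K. Q k) = (\<Sum>k<n. Q k)"
    by (rule sum.mono_neutral_left) (auto simp: K_def)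
  then show "(\<Sum>i<n. U i i) + (\<Sum>k\<in>K. Q k) = Finite_Cartesian_Product.mat 1"
    by (simp add: Q_def sum_subtractf sum_P)
qed (auto simp: K_def U_matrix_units Q_idempotents,
    auto simp: Q_def matrix_diff_mult P_mult_U U_mult_P U_matrix_units)

section \<open>The generated algebra is the span of the units\<close>

lemma U_in_span: "i < n \<Longrightarrow> j < n \<Longrightarrow> U i j \<in> cmat.span units"
  by (rule cmat.span_base) (auto simp: units_def)

text \<open>\<open>P i = Q i + U i i\<close>, where \<open>Q i\<close> is either one of the units or
  zero.\<close>

lemma P_in_span:
  assumes "i < n"
  shows "P i \<in> cmat.span units"
proof -
  have "Q i \<in> cmat.span units"
  proof (cases "i \<in> K")
    case True
    then show ?thesis
      by (intro cmat.span_base) (auto simp: units_def)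
  next
    case False
    then show ?thesis
      using assms by (simp add: K_def cmat.span_zero)
  qed
  then have "Q i + U i i \<in> cmat.span units"
    using assms by (intro cmat.span_add U_in_span)
  then show ?thesis
    by (simp add: Q_def)
qed

text \<open>Inserting the identity as the sum of the projections on both sides gives the terms
  \<open>c j\<close> times \<open>U i j\<close>.\<close>

lemma base_matrix_in_span: "base_matrix x0 \<in> cmat.span units"
proof -
  have "base_matrix x0 = (\<Sum>i<n. P i) ** base_matrix x0 ** (\<Sum>j<n. P j)"
    by (simp add: sum_P)
  also have "\<dots> = (\<Sum>i<n. \<Sum>j<n. P i ** base_matrix x0 ** P j)"
    by (simp add: matrix_sum_mult_left matrix_sum_mult_right) (rule sum.swap)
  also have "\<dots> = (\<Sum>i<n. \<Sum>j<n. mat_scale (c j) (U i j))"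
    using c_nonzero by (intro sum.cong) (auto simp: U_def)
  also have "\<dots> \<in> cmat.span units"
    by (intro cmat.span_sum cmat.span_scale U_in_span) auto
  finally show ?thesis .
qed

text \<open>Both generators are combinations of units. Conversely, any unital subalgebra with both
  generators contains the \<open>P i\<close>, as polynomials in \<open>A\<close>, and therefore all
  \<open>U i j\<close> and \<open>Q i\<close>.\<close>

lemma hull_eq_span: "unital_subalgebra hull {A, base_matrix x0} = cmat.span units"
proof (rule hull_unique)
  have "A \<in> cmat.span units"
    by (subst A_eq_sum_P) (intro cmat.span_sum cmat.span_scale P_in_span, auto)
  then show "{A, base_matrix x0} \<subseteq> cmat.span units"
    using base_matrix_in_span by simp
  show "unital_subalgebra (cmat.span units)"
    by (rule unital_subalgebra_span)
  fix S assume S: "{A, base_matrix x0} \<subseteq> S" "unital_subalgebra S"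
  have sub: "cmat.subspace S" and mult: "\<And>M N. M \<in> S \<Longrightarrow> N \<in> S \<Longrightarrow> M ** N \<in> S"
    using S(2) by (auto simp: unital_subalgebra_def)
  have P: "P i \<in> S" for i
    unfolding P_def using S by (intro matrix_poly_in_subalgebra) auto
  have U: "U i j \<in> S" for i j
    unfolding U_def using S by (intro cmat.subspace_scale[OF sub] mult P) auto
  have "Q i \<in> S" for i
    unfolding Q_def by (intro cmat.subspace_diff[OF sub] P U)
  with U have "units \<subseteq> S"
    by (auto simp: units_def)
  then show "cmat.span units \<subseteq> S"
    using sub by (rule cmat.span_minimal)
qed

section \<open>Nonzero remainders and multiple eigenvalues\<close>

lemma U_mult_vec: "U i i *v v = (inverse (c i) * (P i *v v) $ x0) *s w i"
  by (simp add: U_def w_def base_matrix_mult_vec vec.scale mult.commute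
      flip: matrix_vector_mul_assoc)

lemma Q_mult_w:
  assumes "i < n"
  shows "Q i *v w i = 0"
proof -
  have "P i *v w i = w i"
    using assms by (intro P_eigenvector A_mult_w)
  moreover have "w i $ x0 = c i"
    by (simp add: c_def w_def mult_axis_nth)
  ultimately show ?thesis
    using c_nonzero[OF assms] by (simp add: Q_def matrix_vector_mult_diff_rdistrib U_mult_vec)
qed

text \<open>If \<open>Q i = 0\<close>, then \<open>P i = U i i\<close> fixes the eigenspace but maps
  into the line of \<open>w i\<close>. If \<open>Q i\<close> is nonzero, a nonzero vector in its
  image is an eigenvector off that line, because \<open>Q i\<close> fixes it and kills
  \<open>w i\<close>.\<close>

lemma eig_mult_gt_1_iff:
  assumes i: "i < n"
  shows "eig_mult A (l i) > 1 \<longleftrightarrow> Q i \<noteq> 0"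
proof
  assume mult: "eig_mult A (l i) > 1"
  show "Q i \<noteq> 0"
  proof
    assume Q: "Q i = 0"
    have "v \<in> vec.span {w i}" if "v \<in> eigenspace A (l i)" for v
    proof -
      have "v = P i *v v"
        using that i by (simp add: eigenspace_def P_eigenvector)
      also have "\<dots> = U i i *v v"
        using Q by (simp add: Q_def)
      also have "\<dots> \<in> vec.span {w i}"
        unfolding U_mult_vec by (intro vec.span_scale vec.span_base) simp
      finally show ?thesis .
    qed
    then have "eig_mult A (l i) \<le> card {w i}"
      unfolding eig_mult_def by (intro vec.dim_le_card) auto
    then show False
      using mult by simp
  qed
next
  assume "Q i \<noteq> 0"
  then obtain v where v: "Q i *v v \<noteq> 0"
    by (metis matrix_eq matrix_vector_mult_0)
  let ?u = "Q i *v v"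
  have "P i ** Q i = Q i"
    using i by (simp add: Q_def matrix_diff_mult P_mult_P P_mult_U)
  then have "A ** Q i = mat_scale (l i) (Q i)"
    using A_mult_P[OF i] by (metis mat_scale_mult_left matrix_mul_assoc)
  then have u: "?u \<in> eigenspace A (l i)"
    by (simp add: eigenspace_def matrix_vector_mul_assoc)
  have Qu: "Q i *v ?u = ?u"
    using Q_idempotents[OF i i] by (simp add: matrix_vector_mul_assoc)
  have notin: "?u \<notin> vec.span {w i}"
  proof
    assume "?u \<in> vec.span {w i}"
    then obtain b where "?u = b *s w i"
      by (auto simp: vec.span_singleton)
    then have "Q i *v ?u = 0"
      using Q_mult_w[OF i] by (simp add: vec.scale)
    then show False
      using Qu v by simp
  qed
  \<comment> \<open>Distinctness makes the independent set have two elements.\<close>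
  then have ne: "?u \<noteq> w i"
    using vec.span_base[of "w i" "{w i}"] by auto
  have "vec.independent {?u, w i}"
    using notin w_nonzero[OF i] by (simp add: vec.independent_insert)
  moreover have "{?u, w i} \<subseteq> eigenspace A (l i)"
    using u A_mult_w[OF i] by (simp add: eigenspace_def)
  ultimately have "card {?u, w i} \<le> eig_mult A (l i)"
    unfolding eig_mult_def by (intro vec.independent_card_le_dim)
  then show "eig_mult A (l i) > 1"
    using ne by simp
qed

end

section \<open>Walks and adjacency matrices\<close>

lemma adjacent_sym: "adjacent E x y \<longleftrightarrow> adjacent E y x"
  by (simp add: adjacent_def insert_commute)

lemma adj_matrix_nth: "adj_matrix E $ x $ y = (if adjacent E x y then 1 else 0)"
  by (simp add: adj_matrix_def)

lemma self_adjoint_adj_matrix: "self_adjoint (adj_matrix E)"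
  unfolding self_adjoint_def
proof (intro allI)
  fix v w
  have "herm (adj_matrix E *v v) w =
      (\<Sum>x\<in>UNIV. \<Sum>y\<in>UNIV. (if adjacent E x y then 1 else 0) * v $ y * cnj (w $ x))"
    by (simp add: herm_def matrix_vector_mult_def adj_matrix_def sum_distrib_right)
  also have "\<dots> = (\<Sum>y\<in>UNIV. \<Sum>x\<in>UNIV. (if adjacent E x y then 1 else 0) * v $ y * cnj (w $ x))"
    by (rule sum.swap)
  also have "\<dots> = herm v (adj_matrix E *v w)"
    by (simp add: herm_def matrix_vector_mult_def adj_matrix_def sum_distrib_left adjacent_sym
        if_distrib[of cnj] mult_ac)
      (auto intro!: sum.cong simp: adjacent_sym)
  finally show "herm (adj_matrix E *v v) w = herm v (adj_matrix E *v w)" .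
qed

text \<open>The entry counts walks of length \<open>k\<close>. As a sum of natural numbers it cannot
  vanish by cancellation, so it is nonzero exactly when a walk exists.\<close>

lemma walk_count:
  "\<exists>r::nat. matrix_poly (adj_matrix E) (monom 1 k) $ y $ x = of_nat r \<and>
     (r = 0 \<longleftrightarrow> \<not> (adjacent E ^^ k) x y)"
proof (induction k arbitrary: y)
  case 0
  then show ?case
    by (intro exI[of _ "if x = y then 1 else 0"])
      (auto simp: Finite_Cartesian_Product.mat_def monom_0)
next
  case (Suc k)
  let ?M = "matrix_poly (adj_matrix E) (monom 1 k)"
  obtain r where r: "\<And>z. ?M $ z $ x = of_nat (r z)" "\<And>z. r z = 0 \<longleftrightarrow> \<not> (adjacent E ^^ k) x z"
    using Suc by metis
  have "matrix_poly (adj_matrix E) (monom 1 (Suc k)) $ y $ x =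
      (\<Sum>z\<in>UNIV. (if adjacent E y z then 1 else 0) * of_nat (r z))"
    by (simp add: monom_Suc matrix_matrix_mult_def adj_matrix_nth r)
  also have "\<dots> = of_nat (\<Sum>z\<in>UNIV. if adjacent E y z then r z else 0)"
    by (auto intro!: sum.cong)
  finally have "matrix_poly (adj_matrix E) (monom 1 (Suc k)) $ y $ x =
      of_nat (\<Sum>z\<in>UNIV. if adjacent E y z then r z else 0)" .
  moreover have "(\<Sum>z\<in>UNIV. if adjacent E y z then r z else 0) = 0 \<longleftrightarrow>
      \<not> (adjacent E ^^ Suc k) x y"
  proof -
    have "(\<Sum>z\<in>UNIV. if adjacent E y z then r z else 0) = 0 \<longleftrightarrow>
        (\<forall>z. adjacent E y z \<longrightarrow> r z = 0)"
      by auto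
    also have "\<dots> \<longleftrightarrow> \<not> (adjacent E ^^ Suc k) x y"
      unfolding r(2) relpowp.simps(2) relcompp_apply using adjacent_sym[of E y] by blast
    finally show ?thesis .
  qed
  ultimately show ?case
    by (intro exI conjI)
qed

text \<open>The maximum over the finite vertex set is attained. Connectedness makes the distance the
  length of an actual walk, and its minimality excludes shorter ones.\<close>

lemma ex_vertex_at_diameter:
  assumes "connected_graph E"
  shows "\<exists>y. (adjacent E ^^ diameter_at E x) x y \<and>
    (\<forall>k<diameter_at E x. \<not> (adjacent E ^^ k) x y)"
proof -
  have "diameter_at E x \<in> {graph_dist E x y | y. y \<in> UNIV}"
    unfolding diameter_at_def by (rule Max_in) (auto simp: full_SetCompr_eq)
  then obtain y where y: "diameter_at E x = graph_dist E x y"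
    by auto
  obtain k where "(adjacent E ^^ k) x y"
    using assms unfolding connected_graph_def by (metis rtranclp_imp_relpowp)
  then have "(adjacent E ^^ graph_dist E x y) x y"
    unfolding graph_dist_def by (rule LeastI)
  then show ?thesis
    unfolding y by (auto simp: graph_dist_def dest: not_less_Least)
qed

theorem theorem4p5:
  fixes E :: "'x::finite set set" and x0 :: 'x and D t :: nat
    and l :: "nat \<Rightarrow> complex" and m :: "nat \<Rightarrow> nat"
  assumes graph: "simple_graph E" "connected_graph E"
    and diam: "D = diameter_at E x0"
    and eigs: "bij_betw l {0..D} (eigenvalues (adj_matrix E))"
    and mults: "\<And>i. i \<le> D \<Longrightarrow> m i = eig_mult (adj_matrix E) (l i)"
    and t: "t = card {i \<in> {0..D}. m i > 1}"
  shows "alg_isomorphic (T1_algebra E x0)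
           (alg_direct_sum (full_matrix_algebra (D + 1))
             (alg_direct_sum_family {1..t} (\<lambda>i. complex_algebra)))
         \<and> cmat.dim (T1_set E x0) = (D + 1)^2 + t"
proof -
  obtain y where y: "(adjacent E ^^ D) x0 y" "\<And>k. k < D \<Longrightarrow> \<not> (adjacent E ^^ k) x0 y"
    using ex_vertex_at_diameter[OF graph(2)] diam by blast
  \<comment> \<open>A vertex at distance \<open>D\<close> plays the role of \<open>y0\<close>: no
    walk shorter than \<open>D\<close> reaches it, and one of length \<open>D\<close> does.\<close>
  interpret spectral_base "adj_matrix E" x0 y D l
  proof
    show "matrix_poly (adj_matrix E) (monom 1 k) $ y $ x0 = 0" if "k < D" for k
      using walk_count[of E k y x0] y(2)[OF that] by auto
    show "matrix_poly (adj_matrix E) (monom 1 D) $ y $ x0 \<noteq> 0"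
      using walk_count[of E D y x0] y(1) by auto
  qed (fact self_adjoint_adj_matrix eigs)+
  \<comment> \<open>The ranges agree because \<open>n\<close> is \<open>Suc D\<close>; thus
    \<open>t\<close> counts the scalar summands.\<close>
  have "{i \<in> {0..D}. m i > 1} = K"
    using eig_mult_gt_1_iff mults by (auto simp: K_def n_def)
  then have "t = card K"
    by (simp add: t)
  moreover have "T1_set E x0 = cmat.span units"
    unfolding T1_set_def by (rule hull_eq_span)
  ultimately show ?thesis
    using alg_isomorphic_span_units dim_span_units
    by (simp add: T1_algebra_def n_def block_algebra_def)
qed

end
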